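(* Let $k$ be a positive integer, let $M\in T(k,k,k)$, let $S\subseteq (k)\times(k)$, and let $r_1,\ldots,r_k$ be positive integers such that $$M(l^t_{ij})\leq r_ir_j\quad\text{for all } t\in\{1,2,3\} \text{ and } i,j\in(k),$$ and $$M(l^3_{ij})=r_ir_j\quad\text{for all }(i,j)\in S.$$ Let $n=\sum_{i=1}^k r_i$. Then there exist an ordered partition $\sigma=\{P_1,\ldots,P_k\}$ of $(n)$ with $|P_i|=r_i$ for all $i\in(k)$, and a partial $S'$-Latin square $L\in T(n,n,n)$, where $$S'=\bigcup_{(i,j)\in S}P_i\times P_j,$$ such that $M=((L\circ_1\sigma)\circ_2\sigma)\circ_3\sigma$.
   Context: For a positive integer $n$, $(n)=\{1,\ldots,n\}$. A 3-indexed $n_1\times n_2\times n_3$-matrix is a function $M:(n_1)\times(n_2)\times(n_3)\to\mathbb{R}$; $T(n_1,n_2,n_3)$ is the set of those whose entries are nonnegative integers. For $X\subseteq(n_1)\times(n_2)\times(n_3)$ write $M(X)=\sum_{x\in X}M(x)$. Lines: $l^1_{ab}=\{(x,a,b):x\in(n_1)\}$, $l^2_{ab}=\{(a,x,b):x\in(n_2)\}$, $l^3_{ab}=\{(a,b,x):x\in(n_3)\}$. The line sum of $M$ along a line $l$ is $M(l)$. Partial Latin squares: for $S'\subseteq(n)\times(n)$, a matrix $L\in T(n,n,n)$ is a partial $S'$-Latin square if every line sum of $L$ is at most $1$ and $L(l^3_{ij})=1$ for every $(i,j)\in S'$. Quotients: for an ordered partition $\sigma=\{P_1,\ldots,P_r\}$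 of $(n_i)$, where $i\in\{1,2,3\}$, the quotient matrix $M\circ_i\sigma$ is obtained by replacing the $i$-th index set $(n_i)$ by $(r)$ and summing over blocks: its value at $(x_1,x_2,x_3)$ (with $x_i\in(r)$) is $M(X)$, where $X$ is the product of the sets $\{x_j\}$ for $j\ne i$ in position $j$ and $P_{x_i}$ in position $i$. For example $(M\circ_1\sigma)(x_1,x_2,x_3)=\sum_{y\in P_{x_1}}M(y,x_2,x_3)$. *)

theory Defs
  imports Complex_Main "HOL-Library.FuncSet" "HOL-Library.Disjoint_Sets"
begin

text \<open>
  A $n_1 \times n_2 \times n_3$-matrix is a real function on triples of naturals that is
  extensional (equal to \<^const>\<open>undefined\<close>) outside the 1-based index box of its dimensions
  \<open>(n1, n2, n3)\<close>, so that HOL equality of two such functions is equality of matrices.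
  The value \<open>M(X)\<close> on a set of positions is \<^term>\<open>sum M X\<close>.
\<close>

type_synonym index3 = "nat \<times> nat \<times> nat"

type_synonym matrix3 = "index3 \<Rightarrow> real"

datatype direction = First | Second | Third

fun box :: "index3 \<Rightarrow> index3 set" where
  "box (n1, n2, n3) = {1..n1} \<times> {1..n2} \<times> {1..n3}"

definition nat_matrices :: "index3 \<Rightarrow> matrix3 set" where
  "nat_matrices d = box d \<rightarrow>\<^sub>E \<nat>"

fun line :: "index3 \<Rightarrow> direction \<Rightarrow> nat \<Rightarrow> nat \<Rightarrow> index3 set" where
  "line (n1, n2, n3) First a b = {(x, a, b) |x. x \<in> {1..n1}}"
| "line (n1, n2, n3) Second a b = {(a, x, b) |x. x \<in> {1..n2}}"
| "line (n1, n2, n3) Third a b = {(a, b, x) |x. x \<in> {1..n3}}"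

definition partial_latin_square :: "nat \<Rightarrow> (nat \<times> nat) set \<Rightarrow> matrix3 \<Rightarrow> bool" where
  "partial_latin_square n S L \<longleftrightarrow>
     S \<subseteq> {1..n} \<times> {1..n} \<and>
     L \<in> nat_matrices (n, n, n) \<and>
     (\<forall>t. \<forall>i\<in>{1..n}. \<forall>j\<in>{1..n}. sum L (line (n, n, n) t i j) \<le> 1) \<and>
     (\<forall>(i, j)\<in>S. sum L (line (n, n, n) Third i j) = 1)"

text \<open>Only the values \<open>P 1, \<dots>, P r\<close> of the family matter.\<close>

definition ordered_partition :: "'a set \<Rightarrow> nat \<Rightarrow> (nat \<Rightarrow> 'a set) \<Rightarrow> bool" where
  "ordered_partition A r P \<longleftrightarrow> inj_on P {1..r} \<and> partition_on A (P ` {1..r})"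

fun replace_dim :: "direction \<Rightarrow> nat \<Rightarrow> index3 \<Rightarrow> index3" where
  "replace_dim First r (n1, n2, n3) = (r, n2, n3)"
| "replace_dim Second r (n1, n2, n3) = (n1, r, n3)"
| "replace_dim Third r (n1, n2, n3) = (n1, n2, r)"

fun block :: "direction \<Rightarrow> (nat \<Rightarrow> nat set) \<Rightarrow> index3 \<Rightarrow> index3 set" where
  "block First P (x1, x2, x3) = P x1 \<times> {x2} \<times> {x3}"
| "block Second P (x1, x2, x3) = {x1} \<times> P x2 \<times> {x3}"
| "block Third P (x1, x2, x3) = {x1} \<times> {x2} \<times> P x3"

text \<open>
  The quotient in direction \<open>t\<close> of a matrix \<open>M\<close> of dimensions \<open>d\<close> by the ordered
  partition \<open>P 1, \<dots>, P r\<close>; its own dimensions are \<^term>\<open>replace_dim t r d\<close>.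
\<close>

definition quotient_matrix ::
    "index3 \<Rightarrow> direction \<Rightarrow> nat \<Rightarrow> (nat \<Rightarrow> nat set) \<Rightarrow> matrix3 \<Rightarrow> matrix3" where
  "quotient_matrix d t r P M =
     restrict (\<lambda>x. sum M (block t P x)) (box (replace_dim t r d))"

end

theory Submission
  imports Defs
begin

text \<open>
  Each of the three index sets is split in turn. Splitting one index value of weight \<open>c\<close> means
  splitting a bipartite multigraph (a slice of the matrix), whose vertices \<open>x\<close> have degree at
  most \<open>c \<cdot> a(x)\<close>, into \<open>c\<close> subgraphs with degrees at most \<open>a(x)\<close>. This weighted form of
  Koenig's edge colouring theorem is proved by adding the edges one by one: a new edge is
  accommodated by splitting anew, into two balanced halves, the union of two colour classes, one with
  room at each end. After the three splittings all line sums are at most 1, and on a block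
  \<open>P\<^sub>i \<times> P\<^sub>j\<close> with \<open>(i, j) \<in> S\<close> they add up to the number of lines, so they are all 1.
\<close>

section \<open>Balanced orientations of multigraphs\<close>

text \<open>The column of the signed incidence matrix for an edge from \<open>p\<close> to
  \<open>q\<close>. A loop gives the zero vector, which is wanted: merging two parallel edges
  produces a loop.\<close>

definition incidence :: "'v \<Rightarrow> 'v \<Rightarrow> 'v \<Rightarrow> int" where
  "incidence p q v = of_bool (v = p) - of_bool (v = q)"

text \<open>The sign \<open>t\<close> reverses the second edge if necessary, so that one edge enters
  \<open>v\<close> and the other leaves it. The contributions at \<open>v\<close> cancel and only
  the far ends survive.\<close>

lemma incidence_merge:
  assumes "incidence p q v \<noteq> 0" "incidence p' q' v \<noteq> 0"
  shows "\<exists>t p'' q''. (t = 1 \<or> t = -1) \<and>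
    (\<forall>x. incidence p q x + t * incidence p' q' x = incidence p'' q'' x)"
proof -
  have "v = p \<or> v = q" "v = p' \<or> v = q'"
    using assms by (auto simp: incidence_def)
  then consider "v = p" "v = p'" | "v = p" "v = q'" | "v = q" "v = p'" | "v = q" "v = q'"
    by blast
  then show ?thesis
  proof cases
    case 1
    then have "\<forall>x. incidence p q x + (-1) * incidence p' q' x = incidence q' q x"
      by (simp add: incidence_def)
    then show ?thesis by blast
  next
    case 2
    then have "\<forall>x. incidence p q x + 1 * incidence p' q' x = incidence p' q x"
      by (simp add: incidence_def)
    then show ?thesis by blast
  next
    case 3
    then have "\<forall>x. incidence p q x + 1 * incidence p' q' x = incidence p q' x"
      by (simp add: incidence_def)
    then show ?thesis by blast
  next
    case 4
    then have "\<forall>x. incidence p q x + (-1) * incidence p' q' x = incidence p p' x"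
      by (simp add: incidence_def)
    then show ?thesis by blast
  qed
qed

text \<open>
  The signs \<open>s\<close> orient the edges. Two edges that share a vertex are merged into one edge
  between their other ends, so that their contributions at the shared vertex cancel.
\<close>

lemma balanced_orientation:
  fixes w :: "'e \<Rightarrow> 'v \<Rightarrow> int"
  assumes "finite E" "\<And>e. e \<in> E \<Longrightarrow> \<exists>p q. w e = incidence p q"
  shows "\<exists>s :: 'e \<Rightarrow> int. (\<forall>e\<in>E. s e = 1 \<or> s e = -1) \<and> (\<forall>v. \<bar>\<Sum>e\<in>E. s e * w e v\<bar> \<le> 1)"
  using assms
proof (induction "card E" arbitrary: E w rule: less_induct)
  case less
  show ?case
  proof (cases "\<exists>e\<in>E. \<exists>e'\<in>E. \<exists>v. e \<noteq> e' \<and> w e v \<noteq> 0 \<and> w e' v \<noteq> 0")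
    case True
    then obtain e e' v where e: "e \<in> E" "e' \<in> E" "e \<noteq> e'" "w e v \<noteq> 0" "w e' v \<noteq> 0"
      by blast
    obtain p q p' q' where pq: "w e = incidence p q" "w e' = incidence p' q'"
      using less.prems e by metis
    from e pq obtain t p'' q'' where t: "t = 1 \<or> t = -1"
      and m: "\<forall>x. w e x + t * w e' x = incidence p'' q'' x"
      using incidence_merge[of p q v p' q'] by auto
    \<comment> \<open>The merged edge keeps the name \<open>e\<close> and \<open>e'\<close>
      disappears, so the edge set shrinks.\<close>
    define E0 where "E0 = E - {e, e'}"
    define w' where "w' = w(e := incidence p'' q'')"
    have E: "E = insert e (insert e' E0)" "e \<notin> E0" "e' \<notin> E0" "finite E0"
      using e less.prems(1) by (auto simp: E0_def)
    have "card (insert e E0) < card E" using E e(3) by simp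
    moreover have "finite (insert e E0)" using E by simp
    moreover have "\<And>f. f \<in> insert e E0 \<Longrightarrow> \<exists>p q. w' f = incidence p q"
      using less.prems(2) E by (auto simp: w'_def)
    ultimately obtain s :: "'e \<Rightarrow> int" where s: "\<forall>f\<in>insert e E0. s f = 1 \<or> s f = -1"
      "\<forall>v. \<bar>\<Sum>f\<in>insert e E0. s f * w' f v\<bar> \<le> 1"
      using less.hyps by blast
    \<comment> \<open>\<open>e'\<close> follows the sign of \<open>e\<close> up to \<open>t\<close>;
      together the two then contribute what the merged edge does, at every vertex.\<close>
    define s' where "s' = s(e' := t * s e)"
    have "(\<Sum>f\<in>E. s' f * w f v) = (\<Sum>f\<in>insert e E0. s f * w' f v)" for v
    proof -
      have "(\<Sum>f\<in>E0. s' f * w f v) = (\<Sum>f\<in>E0. s f * w' f v)"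
        using E by (intro sum.cong) (auto simp: s'_def w'_def)
      moreover have "s' e * w e v + s' e' * w e' v = s e * w' e v"
        using e(3) m[rule_format, of v] by (simp add: s'_def w'_def algebra_simps flip: m[rule_format])
      ultimately show ?thesis using E e(3) by simp
    qed
    moreover have "\<forall>f\<in>E. s' f = 1 \<or> s' f = -1"
      using s(1) E t by (auto simp: s'_def)
    ultimately show ?thesis using s(2) by (intro exI[of _ s']) simp
  next
    case False
    \<comment> \<open>No two edges are nonzero at a common vertex, so each sum has at most one
      nonzero term and the constant sign 1 works.\<close>
    have "\<bar>\<Sum>e\<in>E. 1 * w e v\<bar> \<le> 1" for v
    proof (cases "\<exists>e\<in>E. w e v \<noteq> 0")
      case True
      then obtain e where e: "e \<in> E" "w e v \<noteq> 0" by blast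
      have "(\<Sum>f\<in>E. 1 * w f v) = (\<Sum>f\<in>{e}. 1 * w f v)"
        using False e less.prems(1) by (intro sum.mono_neutral_right) auto
      moreover obtain p q where "w e = incidence p q" using less.prems(2) e by blast
      ultimately show ?thesis by (simp add: incidence_def)
    qed simp
    then show ?thesis by (intro exI[of _ "\<lambda>_. 1"]) simp
  qed
qed

section \<open>Halving a bipartite multigraph\<close>

lemma sum_signs:
  fixes s :: "'e \<Rightarrow> int"
  assumes "finite F" "\<forall>e\<in>F. s e = 1 \<or> s e = -1"
  shows "(\<Sum>e\<in>F. s e) = int (card {e\<in>F. s e = 1}) - int (card {e\<in>F. s e \<noteq> 1})"
proof -
  have F: "F = {e\<in>F. s e = 1} \<union> {e\<in>F. s e \<noteq> 1}" by auto
  have "(\<Sum>e\<in>F. s e) = (\<Sum>e\<in>{e\<in>F. s e = 1}. s e) + (\<Sum>e\<in>{e\<in>F. s e \<noteq> 1}. s e)"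
    by (subst F, rule sum.union_disjoint) (use assms(1) in auto)
  also have "(\<Sum>e\<in>{e\<in>F. s e \<noteq> 1}. s e) = (\<Sum>e\<in>{e\<in>F. s e \<noteq> 1}. -1)"
    using assms(2) by (intro sum.cong) auto
  finally show ?thesis by simp
qed

text \<open>The sign of an edge in a balanced orientation decides its half. By bipartiteness all
  edges at a vertex have the same incidence there, so balance makes the two sign classes at that
  vertex differ in size by at most one.\<close>

lemma bipartite_halving:
  fixes u :: "'e \<Rightarrow> 'a" and v :: "'e \<Rightarrow> 'b" and a :: "'a \<Rightarrow> nat" and b :: "'b \<Rightarrow> nat"
  assumes fin: "finite E"
    and a: "\<And>x. card {e\<in>E. u e = x} \<le> 2 * a x"
    and b: "\<And>y. card {e\<in>E. v e = y} \<le> 2 * b y"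
  shows "\<exists>h :: 'e \<Rightarrow> bool. \<forall>i.
    (\<forall>x. card {e\<in>E. u e = x \<and> h e = i} \<le> a x) \<and> (\<forall>y. card {e\<in>E. v e = y \<and> h e = i} \<le> b y)"
proof -
  have half: "card {e\<in>F. (s e = 1) = i} \<le> c"
    if "F \<subseteq> E" "card F \<le> 2 * c" "\<forall>e\<in>E. s e = 1 \<or> s e = -1" "\<bar>\<Sum>e\<in>F. s e\<bar> \<le> 1"
    for F c i and s :: "'e \<Rightarrow> int"
  proof -
    have F: "finite F" using finite_subset[OF that(1) fin] .
    have signs: "\<forall>e\<in>F. s e = 1 \<or> s e = -1" using that(1,3) by blast
    have "card F = card ({e\<in>F. s e = 1} \<union> {e\<in>F. s e \<noteq> 1})" by (rule arg_cong[of _ _ card]) auto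
    also have "\<dots> = card {e\<in>F. s e = 1} + card {e\<in>F. s e \<noteq> 1}"
      using F by (intro card_Un_disjoint) auto
    finally have "card {e\<in>F. s e = 1} + card {e\<in>F. s e \<noteq> 1} \<le> 2 * c" using that(2) by simp
    moreover have "\<bar>int (card {e\<in>F. s e = 1}) - int (card {e\<in>F. s e \<noteq> 1})\<bar> \<le> 1"
      using that(4) unfolding sum_signs[OF F signs] .
    \<comment> \<open>If one class had \<open>c + 1\<close> elements, the other would have at least
      \<open>c\<close>, and the total would exceed \<open>2 * c\<close>.\<close>
    ultimately have "card {e\<in>F. s e = 1} \<le> c" "card {e\<in>F. s e \<noteq> 1} \<le> c" by linarith+
    then show ?thesis by (cases i) auto
  qed
  \<comment> \<open>\<open>Inl\<close> and \<open>Inr\<close> keep the two sides apart even if their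
    types coincide, so no edge is a loop.\<close>
  obtain s :: "'e \<Rightarrow> int" where s: "\<forall>e\<in>E. s e = 1 \<or> s e = -1"
    "\<forall>z. \<bar>\<Sum>e\<in>E. s e * incidence (Inl (u e)) (Inr (v e)) z\<bar> \<le> 1"
    using balanced_orientation[OF fin, of "\<lambda>e. incidence (Inl (u e)) (Inr (v e))"] by blast
  have "(\<Sum>e\<in>E. s e * incidence (Inl (u e)) (Inr (v e)) (Inl x)) = (\<Sum>e\<in>{e\<in>E. u e = x}. s e)" for x
    unfolding sum.inter_filter[OF fin] by (intro sum.cong) (auto simp: incidence_def)
  moreover have "(\<Sum>e\<in>E. s e * incidence (Inl (u e)) (Inr (v e)) (Inr y))
      = - (\<Sum>e\<in>{e\<in>E. v e = y}. s e)" for y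
    unfolding sum.inter_filter[OF fin] sum_negf[symmetric]
    by (intro sum.cong) (auto simp: incidence_def)
  ultimately have "\<bar>\<Sum>e\<in>{e\<in>E. u e = x}. s e\<bar> \<le> 1" "\<bar>\<Sum>e\<in>{e\<in>E. v e = y}. s e\<bar> \<le> 1" for x y
    using s(2)[rule_format, of "Inl x"] s(2)[rule_format, of "Inr y"] by simp_all
  then have "card {e\<in>{e\<in>E. u e = x}. (s e = 1) = i} \<le> a x"
    "card {e\<in>{e\<in>E. v e = y}. (s e = 1) = i} \<le> b y" for x y i
    using half[OF _ a s(1)] half[OF _ b s(1)] by blast+
  then show ?thesis by (intro exI[of _ "\<lambda>e. s e = 1"]) simp
qed

section \<open>Edge colourings with vertex capacities\<close>

lemma card_eq_sum_colours:
  assumes "finite F" "finite C" "\<And>e. e \<in> F \<Longrightarrow> col e \<in> C"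
  shows "card F = (\<Sum>i\<in>C. card {e\<in>F. col e = i})"
  using sum.group[of F C col "\<lambda>_. 1 :: nat"] assms by (simp add: image_subset_iff)

lemma colour_with_room:
  fixes col :: "'e \<Rightarrow> 'c"
  assumes "finite F" "finite C" "\<And>e. e \<in> F \<Longrightarrow> col e \<in> C" "card F < d * card C"
  shows "\<exists>i\<in>C. card {e\<in>F. col e = i} < d"
proof (rule ccontr)
  assume "\<not> ?thesis"
  then have "(\<Sum>i\<in>C. d) \<le> (\<Sum>i\<in>C. card {e\<in>F. col e = i})" by (intro sum_mono) (simp add: not_less)
  also have "\<dots> = card F" by (rule card_eq_sum_colours[OF assms(1-3), symmetric])
  finally show False using assms(4) by (simp add: mult.commute)
qed

text \<open>This treats one side of the bipartition at a time, since the two sides may have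
  different types. With \<open>a\<close> constantly 1 it says that edges of equal colour do not meet
  on that side. Staying within the palette is asserted separately.\<close>

definition capacitated_colouring ::
    "'e set \<Rightarrow> ('e \<Rightarrow> 'v) \<Rightarrow> ('v \<Rightarrow> nat) \<Rightarrow> ('e \<Rightarrow> 'c) \<Rightarrow> bool" where
  "capacitated_colouring E u a col \<longleftrightarrow> (\<forall>x i. card {e\<in>E. u e = x \<and> col e = i} \<le> a x)"

text \<open>The classes \<open>i\<close> and \<open>j\<close> become the two halves of
  \<open>F\<close> given by \<open>h\<close>; all other classes stay. The new colouring is written
  out so that the same one serves both sides of the graph.\<close>

lemma capacitated_colouring_recolour:
  assumes "capacitated_colouring E u a col" "e0 \<notin> E"
    "F = insert e0 {e\<in>E. col e = i \<or> col e = j}" "i \<noteq> j"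
    "\<And>x b. card {e\<in>F. u e = x \<and> h e = b} \<le> a x"
  shows "capacitated_colouring (insert e0 E) u a
    (\<lambda>e. if e \<in> F then if h e then i else j else col e)"
    (is "capacitated_colouring _ _ _ ?col")
  unfolding capacitated_colouring_def
proof (intro allI)
  fix x l
  have F: "e \<in> F \<longleftrightarrow> e = e0 \<or> col e = i \<or> col e = j" if "e \<in> insert e0 E" for e
    using that unfolding assms(3) by blast
  have FE: "e \<in> insert e0 E" if "e \<in> F" for e
    using that unfolding assms(3) by blast
  consider "l = i" | "l = j" | "l \<noteq> i" "l \<noteq> j" by blast
  then show "card {e \<in> insert e0 E. u e = x \<and> ?col e = l} \<le> a x"
  proof cases
    case 1
    have "e \<in> insert e0 E \<and> ?col e = l \<longleftrightarrow> e \<in> F \<and> h e = True" for e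
      using F[of e] FE[of e] 1 assms(4) by argo
    then have "{e \<in> insert e0 E. u e = x \<and> ?col e = l} = {e\<in>F. u e = x \<and> h e = True}"
      by blast
    then show ?thesis using assms(5)[of x True] by argo
  next
    case 2
    have "e \<in> insert e0 E \<and> ?col e = l \<longleftrightarrow> e \<in> F \<and> h e = False" for e
      using F[of e] FE[of e] 2 assms(4) by argo
    then have "{e \<in> insert e0 E. u e = x \<and> ?col e = l} = {e\<in>F. u e = x \<and> h e = False}"
      by blast
    then show ?thesis using assms(5)[of x False] by argo
  next
    case 3
    have "e \<in> insert e0 E \<and> ?col e = l \<longleftrightarrow> e \<in> E \<and> col e = l" for e
      using F[of e] 3 assms(2) by auto
    then have "{e \<in> insert e0 E. u e = x \<and> ?col e = l} = {e\<in>E. u e = x \<and> col e = l}"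
      by blast
    then show ?thesis using assms(1) by (simp add: capacitated_colouring_def)
  qed
qed

lemma capacitated_colouring_insert:
  assumes "capacitated_colouring E u a col" "e0 \<notin> E" "finite E"
    "card {e\<in>E. u e = u e0 \<and> col e = i} < a (u e0)"
  shows "capacitated_colouring (insert e0 E) u a (col(e0 := i))"
  unfolding capacitated_colouring_def
proof (intro allI)
  fix x l
  show "card {e \<in> insert e0 E. u e = x \<and> (col(e0 := i)) e = l} \<le> a x"
  proof (cases "x = u e0 \<and> l = i")
    case True
    then have "{e \<in> insert e0 E. u e = x \<and> (col(e0 := i)) e = l}
        = insert e0 {e\<in>E. u e = u e0 \<and> col e = i}"
      using assms(2) by auto
    then show ?thesis using assms True by simp
  next
    case False
    then have "{e \<in> insert e0 E. u e = x \<and> (col(e0 := i)) e = l} = {e\<in>E. u e = x \<and> col e = l}"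
      using assms(2) by auto
    then show ?thesis using assms(1) by (simp add: capacitated_colouring_def)
  qed
qed

text \<open>The room in colour \<open>i\<close> at \<open>u e0\<close> makes up for the new edge; at
  other vertices two full classes already stay within the bound. This is the even bound that halving
  requires.\<close>

lemma two_colours_degree:
  assumes "capacitated_colouring E u a col" "e0 \<notin> E" "finite E"
    "F = insert e0 {e\<in>E. col e = i \<or> col e = j}"
    "card {e\<in>E. u e = u e0 \<and> col e = i} < a (u e0)"
  shows "card {e\<in>F. u e = x} \<le> 2 * a x"
proof -
  let ?I = "{e\<in>E. u e = x \<and> col e = i}" and ?J = "{e\<in>E. u e = x \<and> col e = j}"
  have J: "card ?I \<le> a x" "card ?J \<le> a x" using assms(1) by (auto simp: capacitated_colouring_def)
  have IJ: "card (?I \<union> ?J) \<le> card ?I + card ?J" by (rule card_Un_le)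
  show ?thesis
  proof (cases "x = u e0")
    case True
    then have "{e\<in>F. u e = x} = insert e0 (?I \<union> ?J)" using assms(4) by auto
    then have "card {e\<in>F. u e = x} \<le> Suc (card (?I \<union> ?J))"
      using assms(3) by (simp add: card_insert_if)
    then show ?thesis using IJ J True assms(5) by simp
  next
    case False
    then have "{e\<in>F. u e = x} = ?I \<union> ?J" using assms(4) by auto
    then show ?thesis using IJ J by simp
  qed
qed

text \<open>With \<open>a\<close> and \<open>b\<close> constantly 1 this is Koenig's theorem.
  Halving takes the place of the usual exchange along an alternating path.\<close>

lemma bipartite_edge_colouring:
  fixes u :: "'e \<Rightarrow> 'a" and v :: "'e \<Rightarrow> 'b"
  assumes "finite E" "finite C"
    and "\<And>x. card {e\<in>E. u e = x} \<le> a x * card C"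
    and "\<And>y. card {e\<in>E. v e = y} \<le> b y * card C"
  shows "\<exists>col. (\<forall>e\<in>E. col e \<in> C) \<and> capacitated_colouring E u a col \<and> capacitated_colouring E v b col"
  using assms
proof (induction E rule: finite_induct)
  case empty
  then show ?case by (simp add: capacitated_colouring_def)
next
  case (insert e0 E)
  have mono: "card {e\<in>E. f e = z} \<le> card {e\<in>insert e0 E. f e = z}" for f :: "'e \<Rightarrow> 'z" and z
    using insert.hyps by (intro card_mono) auto
  have "\<exists>col. (\<forall>e\<in>E. col e \<in> C) \<and> capacitated_colouring E u a col \<and> capacitated_colouring E v b col"
    by (intro insert.IH insert.prems(1) order_trans[OF mono insert.prems(2)]
        order_trans[OF mono insert.prems(3)])
  then obtain col where col: "\<forall>e\<in>E. col e \<in> C" "capacitated_colouring E u a col"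
    "capacitated_colouring E v b col"
    by blast
  \<comment> \<open>The edge \<open>e0\<close> counts towards the degrees at its own ends, so
    without it these are strictly below the total capacity, and the pigeonhole principle yields a
    colour with room at each end.\<close>
  have less: "card {e\<in>E. f e = f e0} < card {e\<in>insert e0 E. f e = f e0}" for f :: "'e \<Rightarrow> 'z"
    using insert.hyps by (intro psubset_card_mono) auto
  obtain i where i: "i \<in> C" "card {e\<in>E. u e = u e0 \<and> col e = i} < a (u e0)"
    using colour_with_room[of "{e\<in>E. u e = u e0}" C col "a (u e0)"] insert.hyps col(1)
      insert.prems(1) less_le_trans[OF less[of u] insert.prems(2)] by (auto simp: conj_assoc)
  obtain j where j: "j \<in> C" "card {e\<in>E. v e = v e0 \<and> col e = j} < b (v e0)"
    using colour_with_room[of "{e\<in>E. v e = v e0}" C col "b (v e0)"] insert.hyps col(1)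
      insert.prems(1) less_le_trans[OF less[of v] insert.prems(3)] by (auto simp: conj_assoc)
  show ?case
  proof (cases "i = j")
    case True
    have "capacitated_colouring (insert e0 E) u a (col(e0 := i))"
      "capacitated_colouring (insert e0 E) v b (col(e0 := i))"
      using col i j insert.hyps True by (auto intro!: capacitated_colouring_insert)
    moreover have "\<forall>e\<in>insert e0 E. (col(e0 := i)) e \<in> C" using col(1) i(1) by simp
    ultimately show ?thesis by blast
  next
    case False
    define F where "F = insert e0 {e\<in>E. col e = i \<or> col e = j}"
    \<comment> \<open>The room at \<open>v e0\<close> is in colour \<open>j\<close>, so
      \<open>two_colours_degree\<close> is applied there with the colours exchanged.\<close>
    have F: "F = insert e0 {e\<in>E. col e = j \<or> col e = i}" by (auto simp: F_def)
    have "card {e\<in>F. u e = x} \<le> 2 * a x" "card {e\<in>F. v e = y} \<le> 2 * b y" for x y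
      using two_colours_degree[OF col(2) insert.hyps(2,1) F_def i(2)]
        two_colours_degree[OF col(3) insert.hyps(2,1) F j(2)] by auto
    moreover have "finite F" using insert.hyps by (simp add: F_def)
    ultimately obtain h :: "'e \<Rightarrow> bool" where h:
      "\<And>x b. card {e\<in>F. u e = x \<and> h e = b} \<le> a x" "\<And>y c. card {e\<in>F. v e = y \<and> h e = c} \<le> b y"
      using bipartite_halving[of F u a v b] by blast
    define col' where "col' = (\<lambda>e. if e \<in> F then if h e then i else j else col e)"
    have "capacitated_colouring (insert e0 E) u a col'" "capacitated_colouring (insert e0 E) v b col'"
      unfolding col'_def
      by (rule capacitated_colouring_recolour[OF col(2) insert.hyps(2) F_def False h(1)]
          capacitated_colouring_recolour[OF col(3) insert.hyps(2) F_def False h(2)])+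
    moreover have "\<forall>e\<in>insert e0 E. col' e \<in> C"
      using col(1) i(1) j(1) by (auto simp: F_def col'_def)
    ultimately show ?thesis by blast
  qed
qed

section \<open>Splitting one index of a matrix\<close>

text \<open>Let \<open>m x y\<close> parallel edges join \<open>x\<close> to \<open>y\<close> and
  let the colours be the new index values. Then \<open>N x y w\<close> counts the edges of colour
  \<open>w\<close> between \<open>x\<close> and \<open>y\<close>.\<close>

lemma split_slice:
  fixes m :: "'a \<Rightarrow> 'b \<Rightarrow> nat"
  assumes "finite A" "finite B" "finite C"
    and a: "\<And>x. x \<in> A \<Longrightarrow> (\<Sum>y\<in>B. m x y) \<le> a x * card C"
    and b: "\<And>y. y \<in> B \<Longrightarrow> (\<Sum>x\<in>A. m x y) \<le> b y * card C"
  shows "\<exists>N :: 'a \<Rightarrow> 'b \<Rightarrow> 'c \<Rightarrow> nat.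
    (\<forall>x\<in>A. \<forall>y\<in>B. (\<Sum>w\<in>C. N x y w) = m x y) \<and>
    (\<forall>w\<in>C. (\<forall>x\<in>A. (\<Sum>y\<in>B. N x y w) \<le> a x) \<and> (\<forall>y\<in>B. (\<Sum>x\<in>A. N x y w) \<le> b y))"
proof -
  \<comment> \<open>The second component numbers the parallel edges.\<close>
  define E where "E = (SIGMA p:A \<times> B. {..<m (fst p) (snd p)})"
  define u where "u = (\<lambda>e :: ('a \<times> 'b) \<times> nat. fst (fst e))"
  define v where "v = (\<lambda>e :: ('a \<times> 'b) \<times> nat. snd (fst e))"
  have E: "finite E" using assms by (auto simp: E_def)
  have E_uv: "u e \<in> A" "v e \<in> B" if "e \<in> E" for e
    using that by (auto simp: E_def u_def v_def)
  have u_sum: "card {e\<in>E. u e = x \<and> Q e} = (\<Sum>y\<in>B. card {e\<in>E. u e = x \<and> v e = y \<and> Q e})" for x Q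
    using card_eq_sum_colours[of "{e\<in>E. u e = x \<and> Q e}" B v] E E_uv assms(2)
    by (simp add: conj_ac)
  have v_sum: "card {e\<in>E. v e = y \<and> Q e} = (\<Sum>x\<in>A. card {e\<in>E. u e = x \<and> v e = y \<and> Q e})" for y Q
    using card_eq_sum_colours[of "{e\<in>E. v e = y \<and> Q e}" A u] E E_uv assms(1)
    by (simp add: conj_ac)
  have m: "card {e\<in>E. u e = x \<and> v e = y} = m x y" if "x \<in> A" "y \<in> B" for x y
  proof -
    have "{e\<in>E. u e = x \<and> v e = y} = {(x, y)} \<times> {..<m x y}"
      using that by (auto simp: E_def u_def v_def)
    then show ?thesis by simp
  qed
  \<comment> \<open>The colouring lemma asks for this bound at every value of the vertex type;
    outside \<open>A\<close> the degree is 0.\<close>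
  have "card {e\<in>E. u e = x} \<le> a x * card C" for x
  proof (cases "x \<in> A")
    case True
    then show ?thesis using u_sum[of x "\<lambda>_. True"] m a[OF True] by simp
  next
    case False
    then have "{e\<in>E. u e = x} = {}" using E_uv by blast
    then show ?thesis by (metis card.empty zero_le)
  qed
  moreover have "card {e\<in>E. v e = y} \<le> b y * card C" for y
  proof (cases "y \<in> B")
    case True
    then show ?thesis using v_sum[of y "\<lambda>_. True"] m b[OF True] by simp
  next
    case False
    then have "{e\<in>E. v e = y} = {}" using E_uv by blast
    then show ?thesis by (metis card.empty zero_le)
  qed
  ultimately obtain col where col: "\<forall>e\<in>E. col e \<in> C" "capacitated_colouring E u a col"
    "capacitated_colouring E v b col"
    using bipartite_edge_colouring[OF E assms(3), of u a v b] by blast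
  define N where "N = (\<lambda>x y w. card {e\<in>E. u e = x \<and> v e = y \<and> col e = w})"
  have "(\<Sum>w\<in>C. N x y w) = m x y" if "x \<in> A" "y \<in> B" for x y
    using card_eq_sum_colours[of "{e\<in>E. u e = x \<and> v e = y}" C col] E col(1) assms(3) m[OF that]
    by (simp add: N_def conj_assoc)
  moreover have "(\<Sum>y\<in>B. N x y w) \<le> a x" "(\<Sum>x\<in>A. N x y w) \<le> b y" for x y w
    using col(2,3) by (simp_all add: N_def capacitated_colouring_def flip: u_sum v_sum)
  ultimately show ?thesis by blast
qed

text \<open>The slices for different \<open>z\<close> are split independently, and disjointness of
  the blocks lets the results be glued. The split index comes last; other positions are reached by
  permuting arguments.\<close>

lemma split_index:
  fixes m :: "'a \<Rightarrow> 'b \<Rightarrow> 'k \<Rightarrow> nat" and P :: "'k \<Rightarrow> 'c set"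
  assumes "finite A" "finite B" "\<And>z. z \<in> K \<Longrightarrow> finite (P z)" "disjoint_family_on P K"
    and "\<And>x z. x \<in> A \<Longrightarrow> z \<in> K \<Longrightarrow> (\<Sum>y\<in>B. m x y z) \<le> a x * card (P z)"
    and "\<And>y z. y \<in> B \<Longrightarrow> z \<in> K \<Longrightarrow> (\<Sum>x\<in>A. m x y z) \<le> b y * card (P z)"
  obtains N :: "'a \<Rightarrow> 'b \<Rightarrow> 'c \<Rightarrow> nat" where
    "\<And>x y z. x \<in> A \<Longrightarrow> y \<in> B \<Longrightarrow> z \<in> K \<Longrightarrow> (\<Sum>w\<in>P z. N x y w) = m x y z"
    "\<And>x w. x \<in> A \<Longrightarrow> w \<in> (\<Union>z\<in>K. P z) \<Longrightarrow> (\<Sum>y\<in>B. N x y w) \<le> a x"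
    "\<And>y w. y \<in> B \<Longrightarrow> w \<in> (\<Union>z\<in>K. P z) \<Longrightarrow> (\<Sum>x\<in>A. N x y w) \<le> b y"
proof -
  have "\<forall>z\<in>K. \<exists>N :: 'a \<Rightarrow> 'b \<Rightarrow> 'c \<Rightarrow> nat.
    (\<forall>x\<in>A. \<forall>y\<in>B. (\<Sum>w\<in>P z. N x y w) = m x y z) \<and>
    (\<forall>w\<in>P z. (\<forall>x\<in>A. (\<Sum>y\<in>B. N x y w) \<le> a x) \<and> (\<forall>y\<in>B. (\<Sum>x\<in>A. N x y w) \<le> b y))"
    using assms by (intro ballI split_slice) auto
  from bchoice[OF this] obtain N :: "'k \<Rightarrow> 'a \<Rightarrow> 'b \<Rightarrow> 'c \<Rightarrow> nat" where
    "\<forall>z\<in>K. (\<forall>x\<in>A. \<forall>y\<in>B. (\<Sum>w\<in>P z. N z x y w) = m x y z) \<and>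
    (\<forall>w\<in>P z. (\<forall>x\<in>A. (\<Sum>y\<in>B. N z x y w) \<le> a x) \<and> (\<forall>y\<in>B. (\<Sum>x\<in>A. N z x y w) \<le> b y))"
    by (rule exE)
  then have N:
    "\<And>x y z. z \<in> K \<Longrightarrow> x \<in> A \<Longrightarrow> y \<in> B \<Longrightarrow> (\<Sum>w\<in>P z. N z x y w) = m x y z"
    "\<And>x z w. z \<in> K \<Longrightarrow> w \<in> P z \<Longrightarrow> x \<in> A \<Longrightarrow> (\<Sum>y\<in>B. N z x y w) \<le> a x"
    "\<And>y z w. z \<in> K \<Longrightarrow> w \<in> P z \<Longrightarrow> y \<in> B \<Longrightarrow> (\<Sum>x\<in>A. N z x y w) \<le> b y"
    by simp_all
  \<comment> \<open>For \<open>w\<close> in some block, this is the index of that block, telling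
    which slice's splitting to use.\<close>
  define \<zeta> where "\<zeta> w = (THE z. z \<in> K \<and> w \<in> P z)" for w
  have \<zeta>: "\<zeta> w = z" if "z \<in> K" "w \<in> P z" for w z
    unfolding \<zeta>_def using that assms(4) by (intro the_equality) (auto simp: disjoint_family_on_def)
  show thesis
  proof (rule that[of "\<lambda>x y w. N (\<zeta> w) x y w"])
    fix x y z assume "x \<in> A" "y \<in> B" "z \<in> K"
    then show "(\<Sum>w\<in>P z. N (\<zeta> w) x y w) = m x y z"
      using N(1) \<zeta> by (metis (no_types, lifting) sum.cong)
  qed (auto simp: \<zeta> N)
qed

section \<open>Interval partitions and sums over lines and blocks\<close>

lemma ex_interval_partition:
  fixes r :: "nat \<Rightarrow> nat"
  shows "\<exists>P. (\<Union>i\<in>{1..k}. P i) = {1..\<Sum>i = 1..k. r i} \<and> disjoint_family_on P {1..k} \<and>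
    (\<forall>i\<in>{1..k}. card (P i) = r i)"
proof (induction k)
  case (Suc k)
  then obtain P where P: "(\<Union>i\<in>{1..k}. P i) = {1..\<Sum>i = 1..k. r i}" "disjoint_family_on P {1..k}"
    "\<forall>i\<in>{1..k}. card (P i) = r i"
    by blast
  let ?n = "\<Sum>i = 1..k. r i"
  define Q where "Q = P(Suc k := {?n<..?n + r (Suc k)})"
  have Q: "Q i = P i" if "i \<in> {1..k}" for i using that by (auto simp: Q_def)
  have QS: "Q (Suc k) = {?n<..?n + r (Suc k)}" by (simp add: Q_def)
  have S: "{1..Suc k} = insert (Suc k) {1..k}" by auto
  have U: "(\<Union>i\<in>{1..k}. Q i) = {1..?n}" using P(1) Q by auto
  have "disjoint_family_on Q {1..k}" using P(2) Q by (simp add: disjoint_family_on_def)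
  then have "disjoint_family_on Q {1..Suc k}"
    unfolding S by (subst disjoint_family_on_insert) (use U QS in auto)
  moreover have "(\<Union>i\<in>{1..Suc k}. Q i) = {1..\<Sum>i = 1..Suc k. r i}"
    unfolding S UN_insert U QS by auto
  moreover have "\<forall>i\<in>{1..Suc k}. card (Q i) = r i"
    unfolding S using P(3) Q QS by auto
  ultimately show ?case by blast
qed (simp add: disjoint_family_on_def)

lemma sum_line:
  "sum f (line (n1, n2, n3) First a b) = (\<Sum>x\<in>{1..n1}. f (x, a, b))"
  "sum f (line (n1, n2, n3) Second a b) = (\<Sum>x\<in>{1..n2}. f (a, x, b))"
  "sum f (line (n1, n2, n3) Third a b) = (\<Sum>x\<in>{1..n3}. f (a, b, x))"
proof -
  have "line (n1, n2, n3) First a b = (\<lambda>x. (x, a, b)) ` {1..n1}"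
    "line (n1, n2, n3) Second a b = (\<lambda>x. (a, x, b)) ` {1..n2}"
    "line (n1, n2, n3) Third a b = (\<lambda>x. (a, b, x)) ` {1..n3}"
    by auto
  then show "sum f (line (n1, n2, n3) First a b) = (\<Sum>x\<in>{1..n1}. f (x, a, b))"
    "sum f (line (n1, n2, n3) Second a b) = (\<Sum>x\<in>{1..n2}. f (a, x, b))"
    "sum f (line (n1, n2, n3) Third a b) = (\<Sum>x\<in>{1..n3}. f (a, b, x))"
    by (simp_all add: sum.reindex inj_on_def)
qed

lemma sum_block:
  "sum f (block First P (x, y, z)) = (\<Sum>u\<in>P x. f (u, y, z))"
  "sum f (block Second P (x, y, z)) = (\<Sum>v\<in>P y. f (x, v, z))"
  "sum f (block Third P (x, y, z)) = (\<Sum>w\<in>P z. f (x, y, w))"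
proof -
  have "block First P (x, y, z) = (\<lambda>u. (u, y, z)) ` P x"
    "block Second P (x, y, z) = (\<lambda>v. (x, v, z)) ` P y"
    "block Third P (x, y, z) = (\<lambda>w. (x, y, w)) ` P z"
    by auto
  then show "sum f (block First P (x, y, z)) = (\<Sum>u\<in>P x. f (u, y, z))"
    "sum f (block Second P (x, y, z)) = (\<Sum>v\<in>P y. f (x, v, z))"
    "sum f (block Third P (x, y, z)) = (\<Sum>w\<in>P z. f (x, y, w))"
    by (simp_all add: sum.reindex inj_on_def)
qed

text \<open>A single value below 1 would push the sum below the cardinality. This later saturates
  all lines over a block at once.\<close>

lemma sum_eq_card_imp_eq_1:
  fixes f :: "'a \<Rightarrow> nat"
  assumes "finite A" "\<And>x. x \<in> A \<Longrightarrow> f x \<le> 1" "sum f A = card A" "x \<in> A"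
  shows "f x = 1"
proof (rule ccontr)
  assume "f x \<noteq> 1"
  then have "sum f A < (\<Sum>x\<in>A. 1)"
    using assms by (intro sum_strict_mono_ex1) (auto intro!: bexI[of _ x] simp: le_less)
  then show False using assms(3) by simp
qed

section \<open>Splitting all three indices and taking quotients\<close>

theorem theorem2:
  fixes k n :: nat and M :: matrix3 and S :: "(nat \<times> nat) set" and r :: "nat \<Rightarrow> nat"
  assumes "k \<ge> 1"
    and "M \<in> nat_matrices (k, k, k)"
    and "S \<subseteq> {1..k} \<times> {1..k}"
    and "\<And>i. i \<in> {1..k} \<Longrightarrow> r i \<ge> 1"
    and "\<And>t i j. i \<in> {1..k} \<Longrightarrow> j \<in> {1..k} \<Longrightarrow>
           sum M (line (k, k, k) t i j) \<le> real (r i * r j)"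
    and "\<And>i j. (i, j) \<in> S \<Longrightarrow> sum M (line (k, k, k) Third i j) = real (r i * r j)"
    and "n = (\<Sum>i = 1..k. r i)"
  shows "\<exists>P L. ordered_partition {1..n} k P \<and>
           (\<forall>i\<in>{1..k}. card (P i) = r i) \<and>
           partial_latin_square n (\<Union>(i, j)\<in>S. P i \<times> P j) L \<and>
           M = quotient_matrix (k, k, n) Third k P
                 (quotient_matrix (k, n, n) Second k P
                   (quotient_matrix (n, n, n) First k P L))"
proof -
  obtain P where P: "(\<Union>i\<in>{1..k}. P i) = {1..n}" "disjoint_family_on P {1..k}"
    "\<And>i. i \<in> {1..k} \<Longrightarrow> card (P i) = r i"
    using ex_interval_partition[of k r] assms(7) by auto
  have finP: "finite (P i)" if "i \<in> {1..k}" for i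
    using P(3)[OF that] assms(4)[OF that] by (intro card_ge_0_finite) simp
  have sum_UN: "(\<Sum>x\<in>{1..n}. f x) = (\<Sum>i\<in>{1..k}. \<Sum>x\<in>P i. f x)" for f :: "nat \<Rightarrow> nat"
    unfolding P(1)[symmetric] using finP P(2)
    by (intro sum.UNION_disjoint) (auto simp: disjoint_family_on_def)

  \<comment> \<open>The entries are natural numbers, so the floor loses nothing on the box.\<close>
  define m where "m = (\<lambda>x y z. nat \<lfloor>M (x, y, z)\<rfloor>)"
  have m: "M (x, y, z) = real (m x y z)" if "x \<in> {1..k}" "y \<in> {1..k}" "z \<in> {1..k}" for x y z
  proof -
    have "(x, y, z) \<in> box (k, k, k)" using that by simp
    then have "M (x, y, z) \<in> \<nat>" using assms(2) unfolding nat_matrices_def by (rule PiE_mem[rotated])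
    then show ?thesis by (auto simp: m_def elim: Nats_cases)
  qed
  have real_sum: "real (sum f {1..k}) = sum g {1..k}"
    if "\<And>i. i \<in> {1..k} \<Longrightarrow> g i = real (f i)" for f g
    using that by simp
  have line1: "(\<Sum>x\<in>{1..k}. m x y z) \<le> r y * r z" if "y \<in> {1..k}" "z \<in> {1..k}" for y z
  proof -
    have "real (\<Sum>x\<in>{1..k}. m x y z) = (\<Sum>x\<in>{1..k}. M (x, y, z))"
      using m that by (intro real_sum) auto
    then have "real (\<Sum>x\<in>{1..k}. m x y z) \<le> real (r y * r z)"
      using assms(5)[OF that, of First] unfolding sum_line by linarith
    then show ?thesis by (rule of_nat_le_iff[THEN iffD1])
  qed
  have line2: "(\<Sum>y\<in>{1..k}. m x y z) \<le> r x * r z" if "x \<in> {1..k}" "z \<in> {1..k}" for x z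
  proof -
    have "real (\<Sum>y\<in>{1..k}. m x y z) = (\<Sum>y\<in>{1..k}. M (x, y, z))"
      using m that by (intro real_sum) auto
    then have "real (\<Sum>y\<in>{1..k}. m x y z) \<le> real (r x * r z)"
      using assms(5)[OF that, of Second] unfolding sum_line by linarith
    then show ?thesis by (rule of_nat_le_iff[THEN iffD1])
  qed
  have m_real3: "real (\<Sum>z\<in>{1..k}. m x y z) = (\<Sum>z\<in>{1..k}. M (x, y, z))"
    if "x \<in> {1..k}" "y \<in> {1..k}" for x y
    using m that by (intro real_sum) auto
  have line3: "(\<Sum>z\<in>{1..k}. m x y z) \<le> r x * r y" if "x \<in> {1..k}" "y \<in> {1..k}" for x y
  proof -
    have "real (\<Sum>z\<in>{1..k}. m x y z) \<le> real (r x * r y)"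
      using m_real3[OF that] assms(5)[OF that, of Third] unfolding sum_line by linarith
    then show ?thesis by (rule of_nat_le_iff[THEN iffD1])
  qed
  have line3_S: "(\<Sum>z\<in>{1..k}. m x y z) = r x * r y" if "(x, y) \<in> S" for x y
  proof -
    have "x \<in> {1..k}" "y \<in> {1..k}" using that assms(3) by auto
    then have "real (\<Sum>z\<in>{1..k}. m x y z) = real (r x * r y)"
      using m_real3 assms(6)[OF that] unfolding sum_line by metis
    then show ?thesis by (rule of_nat_eq_iff[THEN iffD1])
  qed

  \<comment> \<open>The third index is split first. Dividing the bounds \<open>r x * r z\<close> and
    \<open>r y * r z\<close> by \<open>card (P z) = r z\<close> leaves the capacities
    \<open>r x\<close> and \<open>r y\<close>.\<close>
  obtain m1 :: "nat \<Rightarrow> nat \<Rightarrow> nat \<Rightarrow> nat" where m1: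
    "\<And>x y z. x \<in> {1..k} \<Longrightarrow> y \<in> {1..k} \<Longrightarrow> z \<in> {1..k} \<Longrightarrow> (\<Sum>w\<in>P z. m1 x y w) = m x y z"
    "\<And>x w. x \<in> {1..k} \<Longrightarrow> w \<in> {1..n} \<Longrightarrow> (\<Sum>y\<in>{1..k}. m1 x y w) \<le> r x"
    "\<And>y w. y \<in> {1..k} \<Longrightarrow> w \<in> {1..n} \<Longrightarrow> (\<Sum>x\<in>{1..k}. m1 x y w) \<le> r y"
    by (rule split_index[where A = "{1..k}" and B = "{1..k}" and m = m and a = r and b = r,
          OF _ _ finP P(2), unfolded P(1)]) (use line1 line2 P(3) in auto)
  \<comment> \<open>Splitting an index preserves the line sums along it; here this serves both the
    second splitting and the final count over \<open>S\<close>.\<close>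
  have m1_3: "(\<Sum>w\<in>{1..n}. m1 x y w) = (\<Sum>z\<in>{1..k}. m x y z)"
    if "x \<in> {1..k}" "y \<in> {1..k}" for x y
    unfolding sum_UN by (intro sum.cong refl m1(1) that)

  \<comment> \<open>\<open>split_index\<close> splits the last argument: \<open>m2 x w v\<close> and \<open>m3 v w u\<close> are the entries at
    \<open>(x, v, w)\<close> and \<open>(u, v, w)\<close>.\<close>
  obtain m2 :: "nat \<Rightarrow> nat \<Rightarrow> nat \<Rightarrow> nat" where m2:
    "\<And>x w y. x \<in> {1..k} \<Longrightarrow> w \<in> {1..n} \<Longrightarrow> y \<in> {1..k} \<Longrightarrow> (\<Sum>v\<in>P y. m2 x w v) = m1 x y w"
    "\<And>x v. x \<in> {1..k} \<Longrightarrow> v \<in> {1..n} \<Longrightarrow> (\<Sum>w\<in>{1..n}. m2 x w v) \<le> r x"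
    "\<And>w v. w \<in> {1..n} \<Longrightarrow> v \<in> {1..n} \<Longrightarrow> (\<Sum>x\<in>{1..k}. m2 x w v) \<le> 1"
    by (rule split_index[where A = "{1..k}" and B = "{1..n}" and m = "\<lambda>x w y. m1 x y w"
          and a = r and b = "\<lambda>_. 1", OF _ _ finP P(2), unfolded P(1)])
      (use line3 m1(3) m1_3 P(3) in auto)
  have m2_2: "(\<Sum>v\<in>{1..n}. m2 x w v) \<le> r x" if "x \<in> {1..k}" "w \<in> {1..n}" for x w
    unfolding sum_UN using m1(2)[OF that] m2(1) that by simp

  \<comment> \<open>Both kinds of line in the slice of \<open>x\<close> now have sum at most
    \<open>r x = card (P x)\<close>, so both capacities are 1.\<close>
  obtain m3 :: "nat \<Rightarrow> nat \<Rightarrow> nat \<Rightarrow> nat" where m3: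
    "\<And>v w x. v \<in> {1..n} \<Longrightarrow> w \<in> {1..n} \<Longrightarrow> x \<in> {1..k} \<Longrightarrow> (\<Sum>u\<in>P x. m3 v w u) = m2 x w v"
    "\<And>v u. v \<in> {1..n} \<Longrightarrow> u \<in> {1..n} \<Longrightarrow> (\<Sum>w\<in>{1..n}. m3 v w u) \<le> 1"
    "\<And>w u. w \<in> {1..n} \<Longrightarrow> u \<in> {1..n} \<Longrightarrow> (\<Sum>v\<in>{1..n}. m3 v w u) \<le> 1"
    by (rule split_index[where A = "{1..n}" and B = "{1..n}" and m = "\<lambda>v w x. m2 x w v"
          and a = "\<lambda>_. 1" and b = "\<lambda>_. 1", OF _ _ finP P(2), unfolded P(1)])
      (use m2(2) m2_2 P(3) in auto)
  \<comment> \<open>Recombining the blocks gives a line sum of \<open>m2\<close>, which the second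
    splitting already bounded by 1.\<close>
  have m3_1: "(\<Sum>u\<in>{1..n}. m3 v w u) \<le> 1" if "v \<in> {1..n}" "w \<in> {1..n}" for v w
    unfolding sum_UN using m2(3)[OF that(2,1)] m3(1) that by simp

  define L where "L = restrict (\<lambda>(u, v, w). real (m3 v w u)) (box (n, n, n))"
  have L: "L (u, v, w) = real (m3 v w u)" if "u \<in> {1..n}" "v \<in> {1..n}" "w \<in> {1..n}" for u v w
    using that by (simp add: L_def)
  have P_n: "u \<in> {1..n}" if "i \<in> {1..k}" "u \<in> P i" for i u
    using that P(1) by blast

  \<comment> \<open>The blocks are disjoint and, every \<open>r i\<close> being positive, nonempty;
    hence they are distinct.\<close>
  have inj: "inj_on P {1..k}"
  proof (rule inj_onI)
    fix i j assume ij: "i \<in> {1..k}" "j \<in> {1..k}" "P i = P j"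
    then have "P i \<noteq> {}" using P(3)[of i] assms(4)[of i] by auto
    then show "i = j" using ij disjoint_family_onD[OF P(2), of i j] by auto
  qed
  have "{} \<notin> P ` {1..k}"
  proof
    assume "{} \<in> P ` {1..k}"
    then obtain i where "i \<in> {1..k}" "P i = {}" by auto
    then show False using P(3)[of i] assms(4)[of i] by simp
  qed
  then have part: "ordered_partition {1..n} k P"
    using inj P(1,2) by (simp add: ordered_partition_def partition_on_def disjoint_family_on_disjoint_image)

  have le1: "sum L (line (n, n, n) t i j) \<le> 1" if "i \<in> {1..n}" "j \<in> {1..n}" for t i j
  proof -
    \<comment> \<open>These are the lines in directions \<open>First\<close>, \<open>Second\<close>
      and \<open>Third\<close>, in the argument order of \<open>m3\<close>.\<close>
    have "real (\<Sum>x\<in>{1..n}. m3 i j x) \<le> 1" "real (\<Sum>x\<in>{1..n}. m3 x j i) \<le> 1"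
      "real (\<Sum>x\<in>{1..n}. m3 j x i) \<le> 1"
      using m3_1 m3(2,3) that by (simp_all only: of_nat_le_1_iff)
    then show ?thesis
      using that by (cases t) (simp_all only: sum_line, simp_all add: L)
  qed
  have eq1: "sum L (line (n, n, n) Third u v) = 1" if "(i, j) \<in> S" "u \<in> P i" "v \<in> P j" for i j u v
  proof -
    have ij: "i \<in> {1..k}" "j \<in> {1..k}" using that assms(3) by auto
    \<comment> \<open>The total of all lines over the block is found by undoing the splittings down
      to the line sum of \<open>m\<close> at \<open>(i, j)\<close>. It equals
      \<open>r i * r j\<close>, the number of these lines, and each is at most 1.\<close>
    have "(\<Sum>(u, v)\<in>P i \<times> P j. \<Sum>w\<in>{1..n}. m3 v w u) = (\<Sum>u\<in>P i. \<Sum>v\<in>P j. \<Sum>w\<in>{1..n}. m3 v w u)"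
      by (rule sum.cartesian_product[symmetric])
    also have "\<dots> = (\<Sum>v\<in>P j. \<Sum>u\<in>P i. \<Sum>w\<in>{1..n}. m3 v w u)"
      by (rule sum.swap)
    also have "\<dots> = (\<Sum>v\<in>P j. \<Sum>w\<in>{1..n}. \<Sum>u\<in>P i. m3 v w u)"
      by (intro sum.cong refl sum.swap)
    also have "\<dots> = (\<Sum>v\<in>P j. \<Sum>w\<in>{1..n}. m2 i w v)"
      using m3(1) ij P_n by (intro sum.cong refl) auto
    also have "\<dots> = (\<Sum>w\<in>{1..n}. \<Sum>v\<in>P j. m2 i w v)" by (rule sum.swap)
    also have "\<dots> = (\<Sum>w\<in>{1..n}. m1 i j w)" using m2(1) ij by (intro sum.cong refl) auto
    also have "\<dots> = card (P i \<times> P j)"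
      using m1_3 ij line3_S that(1) P(3) by (simp add: card_cartesian_product)
    finally have "(case (u, v) of (u, v) \<Rightarrow> \<Sum>w\<in>{1..n}. m3 v w u) = 1"
      using that finP ij P_n m3(2)
      by (intro sum_eq_card_imp_eq_1[of "P i \<times> P j"]) auto
    then have "real (\<Sum>w\<in>{1..n}. m3 v w u) = 1" by simp
    then show ?thesis using L P_n ij that by (simp only: sum_line) simp
  qed
  have "(\<Union>(i, j)\<in>S. P i \<times> P j) \<subseteq> {1..n} \<times> {1..n}"
    using assms(3) P_n by blast
  moreover have "L \<in> nat_matrices (n, n, n)"
    unfolding nat_matrices_def L_def by (rule restrict_PiE_iff[THEN iffD2]) auto
  ultimately have latin: "partial_latin_square n (\<Union>(i, j)\<in>S. P i \<times> P j) L"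
    unfolding partial_latin_square_def using le1 eq1 by auto

  let ?Q1 = "quotient_matrix (n, n, n) First k P L"
  let ?Q2 = "quotient_matrix (k, n, n) Second k P ?Q1"
  let ?Q3 = "quotient_matrix (k, k, n) Third k P ?Q2"
  \<comment> \<open>The quotients undo the splittings in reverse order, leading from
    \<open>m3\<close> to \<open>m2\<close>, \<open>m1\<close> and finally \<open>m\<close>.\<close>
  have Q1: "?Q1 (x, v, w) = real (m2 x w v)" if "x \<in> {1..k}" "v \<in> {1..n}" "w \<in> {1..n}" for x v w
  proof -
    have "?Q1 (x, v, w) = (\<Sum>u\<in>P x. L (u, v, w))"
      using that unfolding quotient_matrix_def by (simp add: sum_block del: block.simps)
    also have "\<dots> = real (\<Sum>u\<in>P x. m3 v w u)" using L P_n that by simp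
    finally show ?thesis unfolding m3(1)[OF that(2,3,1)] .
  qed
  have Q2: "?Q2 (x, y, w) = real (m1 x y w)" if "x \<in> {1..k}" "y \<in> {1..k}" "w \<in> {1..n}" for x y w
  proof -
    have "?Q2 (x, y, w) = (\<Sum>v\<in>P y. ?Q1 (x, v, w))"
      using that unfolding quotient_matrix_def[of "(k, n, n)"] by (simp add: sum_block del: block.simps)
    also have "\<dots> = real (\<Sum>v\<in>P y. m2 x w v)" using Q1 P_n that by simp
    finally show ?thesis unfolding m2(1)[OF that(1,3,2)] .
  qed
  have Q3: "?Q3 (x, y, z) = M (x, y, z)" if "x \<in> {1..k}" "y \<in> {1..k}" "z \<in> {1..k}" for x y z
  proof -
    have "?Q3 (x, y, z) = (\<Sum>w\<in>P z. ?Q2 (x, y, w))"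
      using that unfolding quotient_matrix_def[of "(k, k, n)"] by (simp add: sum_block del: block.simps)
    also have "\<dots> = real (\<Sum>w\<in>P z. m1 x y w)" using Q2 P_n that by simp
    finally show ?thesis unfolding m1(1)[OF that] m[OF that] .
  qed
  \<comment> \<open>Both sides are \<open>undefined\<close> outside the box, so agreement on the box
    suffices.\<close>
  have "M = ?Q3"
  proof (rule extensionalityI[where A = "box (k, k, k)"])
    show "M \<in> extensional (box (k, k, k))" using assms(2) by (simp add: nat_matrices_def PiE_def)
    show "?Q3 \<in> extensional (box (k, k, k))" by (simp add: quotient_matrix_def del: box.simps)
    show "M p = ?Q3 p" if "p \<in> box (k, k, k)" for p
      using that Q3 by (cases p) auto
  qed
  then show ?thesis using part P(3) latin by blast
qed

end
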